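(* Let $K$ be a field, $A = K[X_1,\ldots,X_n]$, and let $I \subsetneq A$ be a squarefree lexsegment ideal generated in degree $d$. Then $I$ is a universal squarefree lexsegment ideal (USLI) of $A$ if and only if $|G(I)| \le n-d+1$.
   Context: $A=K[X_1,\dots,X_n]$ is standard graded. For a monomial ideal $I$, $G(I)$ is its unique minimal set of monomial generators; $I$ is generated in degree $d$ ($d\ge 1$) if $G(I)$ is nonempty and all its elements have degree $d$. For squarefree monomials of the same degree $u=X_{i_1}\cdots X_{i_d}$, $v=X_{j_1}\cdots X_{j_d}$ with $i_1<\cdots<i_d$ and $j_1<\cdots<j_d$, write $u>_{\mathrm{slex}}v$ if for some $1\le s\le d$ one has $i_1=j_1,\ldots,i_{s-1}=j_{s-1}$ and $i_s<j_s$. A monomial ideal $I\subsetneq A$ is a squarefree lexsegment ideal if it is generated by squarefree monomials and for all squarefree monomials $u\in I$ and all squarefree monomials $v\in A$ with $\deg u=\deg v$ and $v>_{\mathrm{slex}}u$ one has $v\in I$. For $m\ge1$ put $A_{[m]}=K[X_1,\ldots,X_n,X_{n+1},\ldots,X_{n+m}]$. A squarefree lexsegment ideal $I$ of $A$ is a universal squarefree lexsegment ideal (USLI) if for every integer $m\ge 1$ the ideal $IA_{[m]}$ is a squarefree lexsegment ideal of $A_{[m]}$. *)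

theory Defs
  imports "HOL-Library.Poly_Mapping" "HOL-Algebra.Ideal"
begin

type_synonym monom = "nat \<Rightarrow>\<^sub>0 nat"

type_synonym 'k poly = "monom \<Rightarrow>\<^sub>0 'k"

text \<open>
  Monomials are represented by their exponent vectors; \<open>mon u\<close> is the monomial \<open>u\<close> as a polynomial.
  The rings \<open>K[X\<^sub>1, \<dots>, X\<^sub>n]\<close>, for varying \<open>n\<close>, are subrings of the polynomial ring in
  countably many variables, so the embedding of \<open>K[X\<^sub>1, \<dots>, X\<^sub>n]\<close> into
  \<open>K[X\<^sub>1, \<dots>, X\<^bsub>n+m\<^esub>]\<close> is the set-theoretic inclusion.
\<close>

definition mon :: "monom \<Rightarrow> 'k::field poly" where
  "mon u = Poly_Mapping.single u 1"

definition monoms :: "nat \<Rightarrow> monom set" where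
  "monoms n = {u. Poly_Mapping.keys u \<subseteq> {1..n}}"

definition poly_ring :: "nat \<Rightarrow> 'k::field poly ring" where
  "poly_ring n =
     \<lparr>carrier = {p. Poly_Mapping.keys p \<subseteq> monoms n}, monoid.mult = (*), one = 1, zero = 0, add = (+)\<rparr>"

definition mdeg :: "monom \<Rightarrow> nat" where
  "mdeg u = (\<Sum>i\<in>Poly_Mapping.keys u. Poly_Mapping.lookup u i)"

definition sqfree :: "monom \<Rightarrow> bool" where
  "sqfree u \<longleftrightarrow> (\<forall>i. Poly_Mapping.lookup u i \<le> 1)"

text \<open>
  For squarefree \<open>u\<close>, the product of the variables with indices \<open>i\<^sub>1 < \<dots> < i\<^sub>d\<close>,
  \<open>indices u\<close> is \<open>[i\<^sub>1, \<dots>, i\<^sub>d]\<close>.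
\<close>

definition indices :: "monom \<Rightarrow> nat list" where
  "indices u = sorted_list_of_set (Poly_Mapping.keys u)"

text \<open>\<open>slex_gt u v\<close> means \<open>u >\<^sub>s\<^sub>l\<^sub>e\<^sub>x v\<close>; positions in the lists are counted from \<open>0\<close>.\<close>

definition slex_gt :: "monom \<Rightarrow> monom \<Rightarrow> bool" where
  "slex_gt u v \<longleftrightarrow>
     sqfree u \<and> sqfree v \<and> mdeg u = mdeg v \<and>
     (\<exists>s<mdeg u. (\<forall>t<s. indices u ! t = indices v ! t) \<and> indices u ! s < indices v ! s)"

definition monomial_ideal :: "nat \<Rightarrow> 'k::field poly set \<Rightarrow> bool" where
  "monomial_ideal n I \<longleftrightarrow> (\<exists>S \<subseteq> monoms n. I = Idl\<^bsub>poly_ring n\<^esub> (mon ` S))"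

definition min_gens :: "nat \<Rightarrow> 'k::field poly set \<Rightarrow> monom set \<Rightarrow> bool" where
  "min_gens n I S \<longleftrightarrow>
     S \<subseteq> monoms n \<and> I = Idl\<^bsub>poly_ring n\<^esub> (mon ` S) \<and>
     (\<forall>T. T \<subset> S \<longrightarrow> I \<noteq> Idl\<^bsub>poly_ring n\<^esub> (mon ` T))"

text \<open>Meaningful for monomial ideals, for which \<open>min_gens n I\<close> is satisfied by exactly one set.\<close>

definition G :: "nat \<Rightarrow> 'k::field poly set \<Rightarrow> monom set" where
  "G n I = (THE S. min_gens n I S)"

definition generated_in_degree :: "nat \<Rightarrow> 'k::field poly set \<Rightarrow> nat \<Rightarrow> bool" where
  "generated_in_degree n I d \<longleftrightarrow>
     monomial_ideal n I \<and> d \<ge> 1 \<and> G n I \<noteq> {} \<and> (\<forall>u\<in>G n I. mdeg u = d)"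

definition sqfree_lexsegment :: "nat \<Rightarrow> 'k::field poly set \<Rightarrow> bool" where
  "sqfree_lexsegment n I \<longleftrightarrow>
     I \<subset> carrier (poly_ring n) \<and>
     (\<exists>S \<subseteq> monoms n. (\<forall>u\<in>S. sqfree u) \<and> I = Idl\<^bsub>poly_ring n\<^esub> (mon ` S)) \<and>
     (\<forall>u\<in>monoms n. \<forall>v\<in>monoms n.
        sqfree u \<and> mon u \<in> I \<and> sqfree v \<and> mdeg u = mdeg v \<and> slex_gt v u \<longrightarrow> mon v \<in> I)"

definition USLI :: "nat \<Rightarrow> 'k::field poly set \<Rightarrow> bool" where
  "USLI n I \<longleftrightarrow>
     sqfree_lexsegment n I \<and>
     (\<forall>m\<ge>1. sqfree_lexsegment (n + m) (Idl\<^bsub>poly_ring (n + m)\<^esub> I))"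

lemma cring_poly_ring: "cring (poly_ring n :: 'k::field poly ring)"
proof (rule cringI)
  let ?R = "poly_ring n :: 'k poly ring"
  have minus: "- p \<in> carrier ?R" if "p \<in> carrier ?R" for p
    using that by (auto simp: poly_ring_def in_keys_iff subset_iff)
  show "abelian_group ?R"
  proof (rule abelian_groupI)
    fix x assume "x \<in> carrier ?R"
    then show "\<exists>y\<in>carrier ?R. y \<oplus>\<^bsub>?R\<^esub> x = \<zero>\<^bsub>?R\<^esub>"
      using minus by (intro bexI[of _ "- x"]) (auto simp: poly_ring_def)
  qed (auto simp: poly_ring_def add_ac dest!: subsetD[OF keys_add])
  show "comm_monoid ?R"
  proof (rule comm_monoidI)
    fix x y assume xy: "x \<in> carrier ?R" "y \<in> carrier ?R"
    have "u \<in> monoms n" if u: "u \<in> Poly_Mapping.keys (x * y)" for u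
    proof -
      obtain a b where "u = a + b" "a \<in> Poly_Mapping.keys x" "b \<in> Poly_Mapping.keys y"
        using u keys_mult[of x y] by blast
      moreover from this have "a \<in> monoms n" "b \<in> monoms n"
        using xy by (auto simp: poly_ring_def)
      ultimately show ?thesis
        using keys_add[of a b] unfolding monoms_def by blast
    qed
    then show "x \<otimes>\<^bsub>?R\<^esub> y \<in> carrier ?R"
      by (auto simp: poly_ring_def)
  qed (auto simp: poly_ring_def monoms_def mult_ac)
qed (auto simp: poly_ring_def algebra_simps)

end

theory Submission
  imports Defs
begin

text \<open>
  Both conditions are equivalent to every minimal generator being divisible by
  \<open>X\<^sub>1 \<cdots> X\<^bsub>d-1\<^esub>\<close>. There are exactly \<open>n - d + 1\<close> squarefree monomials of degree
  \<open>d\<close> with that property, and they are the largest ones, so the lexsegment property turns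
  divisibility into the bound on the number of generators. If some generator \<open>w\<close> is not divisible by
  \<open>X\<^sub>1 \<cdots> X\<^bsub>d-1\<^esub>\<close>, then \<open>X\<^sub>1 \<cdots> X\<^bsub>d-1\<^esub> X\<^bsub>n+1\<^esub>\<close> is larger than \<open>w\<close>, but it does
  not lie in the extension of the ideal by one variable.
\<close>

section \<open>Monomial ideals\<close>

text \<open>Divisibility of monomials, written additively because multiplying monomials adds
  exponent vectors.\<close>

definition mon_dvd :: "monom \<Rightarrow> monom \<Rightarrow> bool" where
  "mon_dvd s u \<longleftrightarrow> (\<exists>a. u = s + a)"

lemma mon_dvd_refl: "mon_dvd u u"
  unfolding mon_dvd_def by (metis add.right_neutral)

lemma mon_dvd_trans: "mon_dvd s t \<Longrightarrow> mon_dvd t u \<Longrightarrow> mon_dvd s u"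
  unfolding mon_dvd_def by (metis add.assoc)

lemma keys_add_monom: "Poly_Mapping.keys (u + v) = Poly_Mapping.keys u \<union> Poly_Mapping.keys v"
  for u v :: monom
  by (auto simp: in_keys_iff lookup_add)

lemma mdeg_eq_sum:
  assumes "finite A" "Poly_Mapping.keys u \<subseteq> A"
  shows "mdeg u = (\<Sum>i\<in>A. Poly_Mapping.lookup u i)"
  unfolding mdeg_def using assms
  by (intro sum.mono_neutral_left) (auto simp: in_keys_iff)

lemma mdeg_add: "mdeg (u + v) = mdeg u + mdeg v"
  by (simp add: mdeg_eq_sum[of "Poly_Mapping.keys u \<union> Poly_Mapping.keys v"] keys_add_monom
      lookup_add sum.distrib)

lemma mdeg_eq_0_iff: "mdeg u = 0 \<longleftrightarrow> u = 0"
  unfolding mdeg_def by (auto simp: in_keys_iff intro!: poly_mapping_eqI)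

lemma mon_dvd_mdeg_le: "mon_dvd s u \<Longrightarrow> mdeg s \<le> mdeg u"
  unfolding mon_dvd_def by (auto simp: mdeg_add)

text \<open>The cofactor has degree 0, so it is the monomial 1. This turns divisibility into
  equality wherever all generators share one degree.\<close>

lemma mon_dvd_mdeg_eq: "mon_dvd s u \<Longrightarrow> mdeg s = mdeg u \<Longrightarrow> s = u"
  unfolding mon_dvd_def by (auto simp: mdeg_add mdeg_eq_0_iff)

text \<open>The span over \<open>K\<close> of the monomials divisible by a member of
  \<open>S\<close>: an explicit form of the generated ideal, in which membership is checked term by
  term.\<close>

definition mon_multiples :: "nat \<Rightarrow> monom set \<Rightarrow> 'k::field poly set" where
  "mon_multiples n S =
     {p. Poly_Mapping.keys p \<subseteq> monoms n \<and> (\<forall>u\<in>Poly_Mapping.keys p. \<exists>s\<in>S. mon_dvd s u)}"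

lemma ideal_mon_multiples: "ideal (mon_multiples n S :: 'k::field poly set) (poly_ring n)"
proof -
  let ?R = "poly_ring n :: 'k poly ring"
  interpret cring ?R by (rule cring_poly_ring)
  have closed: "x * y \<in> mon_multiples n S"
    if x: "x \<in> mon_multiples n S" and y: "y \<in> carrier ?R" for x y :: "'k poly"
  proof -
    have "x \<otimes>\<^bsub>?R\<^esub> y \<in> carrier ?R"
      using x y by (intro m_closed) (auto simp: mon_multiples_def poly_ring_def)
    moreover have "\<exists>s\<in>S. mon_dvd s u" if u: "u \<in> Poly_Mapping.keys (x * y)" for u
    proof -
      obtain a b where "u = a + b" "a \<in> Poly_Mapping.keys x"
        using u keys_mult[of x y] by blast
      then show ?thesis
        using x mon_dvd_trans unfolding mon_multiples_def mon_dvd_def by blast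
    qed
    ultimately show ?thesis
      by (auto simp: mon_multiples_def poly_ring_def)
  qed
  show ?thesis
  proof (rule idealI[OF ring_axioms])
    show "subgroup (mon_multiples n S) (add_monoid ?R)"
    proof (rule add.subgroupI)
      fix x :: "'k poly" assume x: "x \<in> mon_multiples n S"
      then have "\<ominus>\<^bsub>?R\<^esub> x = - x"
        by (intro minus_equality) (auto simp: mon_multiples_def poly_ring_def in_keys_iff subset_iff)
      then show "\<ominus>\<^bsub>?R\<^esub> x \<in> mon_multiples n S"
        using x by (auto simp: mon_multiples_def in_keys_iff subset_iff)
    next
      fix x y :: "'k poly"
      assume "x \<in> mon_multiples n S" "y \<in> mon_multiples n S"
      then show "x \<oplus>\<^bsub>?R\<^esub> y \<in> mon_multiples n S"
        using keys_add[of x y] unfolding mon_multiples_def poly_ring_def by auto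
    next
      have "0 \<in> (mon_multiples n S :: 'k poly set)"
        by (simp add: mon_multiples_def)
      then show "mon_multiples n S \<noteq> ({} :: 'k poly set)"
        by blast
    qed (auto simp: mon_multiples_def poly_ring_def)
  qed (use closed in \<open>auto simp: poly_ring_def mult.commute\<close>)
qed

text \<open>The right-hand side is an ideal containing the generators, which gives one inclusion.
  For the other, a polynomial is the sum of its terms, and each term is a multiple of a
  generator.\<close>

lemma Idl_mon_eq:
  assumes S: "S \<subseteq> monoms n"
  shows "Idl\<^bsub>poly_ring n\<^esub> (mon ` S) = (mon_multiples n S :: 'k::field poly set)"
proof
  let ?R = "poly_ring n :: 'k poly ring"
  interpret cring ?R by (rule cring_poly_ring)
  have sub: "mon ` S \<subseteq> carrier ?R"
    using S by (auto simp: poly_ring_def mon_def)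
  show "Idl\<^bsub>?R\<^esub> (mon ` S) \<subseteq> mon_multiples n S"
    using S by (intro genideal_minimal ideal_mon_multiples)
      (auto simp: mon_multiples_def mon_def intro: mon_dvd_refl)
  interpret J: ideal "Idl\<^bsub>?R\<^esub> (mon ` S)" ?R
    by (rule genideal_ideal[OF sub])
  \<comment> \<open>The index set \<open>A\<close> and the coefficients \<open>c\<close> are
    decoupled from any polynomial so that the induction can shrink \<open>A\<close> and leave
    \<open>c\<close> fixed.\<close>
  have closed: "(\<Sum>u\<in>A. Poly_Mapping.single u (c u)) \<in> Idl\<^bsub>?R\<^esub> (mon ` S)"
    if "finite A" "A \<subseteq> monoms n" "\<forall>u\<in>A. \<exists>s\<in>S. mon_dvd s u" for A and c :: "monom \<Rightarrow> 'k"
    using that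
  proof (induction A rule: finite_induct)
    case empty
    then show ?case
      using J.zero_closed by (simp add: poly_ring_def)
  next
    case (insert u A)
    obtain s a where s: "s \<in> S" and u: "u = s + a"
      using insert.prems unfolding mon_dvd_def by blast
    \<comment> \<open>The coefficient is attached to the cofactor \<open>a\<close>, which uses only
      variables of \<open>u\<close> and so stays in the ring.\<close>
    have "Poly_Mapping.single a (c u) \<in> carrier ?R"
      using insert.prems u by (auto simp: poly_ring_def monoms_def keys_add_monom)
    moreover have "mon s \<in> Idl\<^bsub>?R\<^esub> (mon ` S)"
      using genideal_self[OF sub] s by blast
    ultimately have "mon s \<otimes>\<^bsub>?R\<^esub> Poly_Mapping.single a (c u) \<in> Idl\<^bsub>?R\<^esub> (mon ` S)"
      by (intro J.I_r_closed)
    then have "Poly_Mapping.single u (c u) \<in> Idl\<^bsub>?R\<^esub> (mon ` S)"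
      by (simp add: poly_ring_def mon_def mult_single u)
    moreover have "(\<Sum>u\<in>A. Poly_Mapping.single u (c u)) \<in> Idl\<^bsub>?R\<^esub> (mon ` S)"
      using insert by auto
    ultimately have "Poly_Mapping.single u (c u) \<oplus>\<^bsub>?R\<^esub> (\<Sum>u\<in>A. Poly_Mapping.single u (c u))
        \<in> Idl\<^bsub>?R\<^esub> (mon ` S)"
      by (rule J.a_closed)
    then show ?case
      using insert.hyps by (simp add: poly_ring_def)
  qed
  show "mon_multiples n S \<subseteq> Idl\<^bsub>?R\<^esub> (mon ` S)"
  proof
    fix p :: "'k poly" assume p: "p \<in> mon_multiples n S"
    have "p = (\<Sum>u\<in>Poly_Mapping.keys p. Poly_Mapping.single u (Poly_Mapping.lookup p u))"
      by (rule poly_mapping_eqI) (auto simp: lookup_sum lookup_single when_def in_keys_iff)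
    then show "p \<in> Idl\<^bsub>?R\<^esub> (mon ` S)"
      using closed[of "Poly_Mapping.keys p" "Poly_Mapping.lookup p"] p
      by (simp add: mon_multiples_def)
  qed
qed

lemma mon_in_mon_multiples_iff:
  "(mon u :: 'k::field poly) \<in> mon_multiples n S \<longleftrightarrow> u \<in> monoms n \<and> (\<exists>s\<in>S. mon_dvd s u)"
  by (auto simp: mon_multiples_def mon_def)

lemma mon_in_Idl_iff:
  assumes "S \<subseteq> monoms n"
  shows "(mon u :: 'k::field poly) \<in> Idl\<^bsub>poly_ring n\<^esub> (mon ` S)
    \<longleftrightarrow> u \<in> monoms n \<and> (\<exists>s\<in>S. mon_dvd s u)"
  by (simp add: Idl_mon_eq[OF assms] mon_in_mon_multiples_iff)

section \<open>Extension of monomial ideals to more variables\<close>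

lemma monoms_mono: "n \<le> n' \<Longrightarrow> monoms n \<subseteq> monoms n'"
  by (auto simp: monoms_def)

lemma Idl_extension:
  assumes S: "S \<subseteq> monoms n" and "n \<le> n'"
  shows "Idl\<^bsub>poly_ring n'\<^esub> (Idl\<^bsub>poly_ring n\<^esub> (mon ` S))
    = (Idl\<^bsub>poly_ring n'\<^esub> (mon ` S) :: 'k::field poly set)"
proof
  let ?R = "poly_ring n' :: 'k poly ring" and ?I = "Idl\<^bsub>poly_ring n\<^esub> (mon ` S) :: 'k poly set"
  interpret cring ?R by (rule cring_poly_ring)
  have S': "S \<subseteq> monoms n'" and le: "monoms n \<subseteq> monoms n'"
    using assms monoms_mono by blast+
  have sub: "?I \<subseteq> mon_multiples n' S"
    using le by (auto simp: Idl_mon_eq[OF S] mon_multiples_def)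
  then show "Idl\<^bsub>?R\<^esub> ?I \<subseteq> Idl\<^bsub>?R\<^esub> (mon ` S)"
    unfolding Idl_mon_eq[OF S'] by (intro genideal_minimal ideal_mon_multiples)
  have "mon ` S \<subseteq> ?I"
    using S mon_dvd_refl by (fastforce simp: mon_in_Idl_iff)
  moreover have "?I \<subseteq> carrier ?R"
    using sub by (auto simp: mon_multiples_def poly_ring_def)
  ultimately show "Idl\<^bsub>?R\<^esub> (mon ` S) \<subseteq> Idl\<^bsub>?R\<^esub> ?I"
    using genideal_self genideal_ideal by (intro genideal_minimal) blast+
qed

text \<open>\<open>M\<close> consists of the monomials of \<open>I\<close> that are minimal under
  divisibility. The second clause yields both minimality and uniqueness, and later carries
  squarefreeness from an arbitrary generating set over to \<open>G n I\<close>.\<close>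

lemma min_gens_unique:
  fixes I :: "'k::field poly set"
  assumes "monomial_ideal n I"
  shows "\<exists>M. min_gens n I M \<and> (\<forall>T\<subseteq>monoms n. I = Idl\<^bsub>poly_ring n\<^esub> (mon ` T) \<longrightarrow> M \<subseteq> T)"
proof -
  obtain S where S: "S \<subseteq> monoms n" and I: "I = Idl\<^bsub>poly_ring n\<^esub> (mon ` S)"
    using assms unfolding monomial_ideal_def by blast
  define M where "M = {u \<in> monoms n. mon u \<in> I \<and> (\<forall>v. mon v \<in> I \<longrightarrow> mon_dvd v u \<longrightarrow> v = u)}"
  \<comment> \<open>Some \<open>t\<close> in \<open>T\<close> divides \<open>u\<close>; as
    \<open>t\<close> lies in \<open>I\<close>, minimality of \<open>u\<close> forces
    \<open>t = u\<close>.\<close>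
  have sub: "M \<subseteq> T" if T: "T \<subseteq> monoms n" and IT: "I = Idl\<^bsub>poly_ring n\<^esub> (mon ` T)" for T
  proof
    fix u assume u: "u \<in> M"
    then obtain t where t: "t \<in> T" "mon_dvd t u"
      using IT T by (auto simp: M_def mon_in_Idl_iff)
    moreover have "mon t \<in> I"
      unfolding IT mon_in_Idl_iff[OF T] using t T mon_dvd_refl by blast
    ultimately show "u \<in> T"
      using u by (auto simp: M_def)
  qed
  \<comment> \<open>A divisor of \<open>u\<close> in \<open>I\<close> of least degree is minimal
    under divisibility, since a proper divisor would have smaller degree.\<close>
  have ex: "\<exists>t\<in>M. mon_dvd t u" if u: "mon u \<in> I" for u
  proof -
    obtain t where t: "mon t \<in> I" "mon_dvd t u"
      and least: "\<And>v. mon v \<in> I \<Longrightarrow> mon_dvd v u \<Longrightarrow> mdeg t \<le> mdeg v"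
      using ex_has_least_nat[of "\<lambda>v. mon v \<in> I \<and> mon_dvd v u" u mdeg] u mon_dvd_refl by blast
    have "v = t" if "mon v \<in> I" "mon_dvd v t" for v
      using that least[of v] t mon_dvd_trans[of v t u] mon_dvd_mdeg_le[of v t]
      by (intro mon_dvd_mdeg_eq) auto
    moreover have "t \<in> monoms n"
      using t S by (simp add: I mon_in_Idl_iff)
    ultimately show ?thesis
      using t by (auto simp: M_def)
  qed
  have M: "M \<subseteq> monoms n"
    by (auto simp: M_def)
  have iff: "(\<exists>t\<in>M. mon_dvd t u) \<longleftrightarrow> (\<exists>s\<in>S. mon_dvd s u)" if "u \<in> monoms n" for u
    using that ex[of u] sub[OF S I] by (auto simp: I mon_in_Idl_iff[OF S])
  have "mon_multiples n S = (mon_multiples n M :: 'k poly set)"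
    unfolding mon_multiples_def using iff by blast
  then have gen: "I = Idl\<^bsub>poly_ring n\<^esub> (mon ` M)"
    unfolding I Idl_mon_eq[OF S] Idl_mon_eq[OF M] .
  have "min_gens n I M"
    unfolding min_gens_def using M gen sub by blast
  then show ?thesis
    using sub by blast
qed

lemma min_gens_G:
  fixes I :: "'k::field poly set"
  assumes "monomial_ideal n I"
  shows "min_gens n I (G n I)"
    and "T \<subseteq> monoms n \<Longrightarrow> I = Idl\<^bsub>poly_ring n\<^esub> (mon ` T) \<Longrightarrow> G n I \<subseteq> T"
proof -
  obtain M where M: "min_gens n I M"
    and sub: "\<And>T. T \<subseteq> monoms n \<Longrightarrow> I = Idl\<^bsub>poly_ring n\<^esub> (mon ` T) \<Longrightarrow> M \<subseteq> T"
    using min_gens_unique[OF assms] by blast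
  \<comment> \<open>\<open>T\<close> contains \<open>M\<close>, and a proper inclusion would
    contradict the minimality of \<open>T\<close>, because \<open>M\<close> already generates
    \<open>I\<close>.\<close>
  have "T = M" if "min_gens n I T" for T
    using that M sub[of T] unfolding min_gens_def by blast
  then have "G n I = M"
    unfolding G_def using M by (intro the_equality)
  then show "min_gens n I (G n I)"
    and "T \<subseteq> monoms n \<Longrightarrow> I = Idl\<^bsub>poly_ring n\<^esub> (mon ` T) \<Longrightarrow> G n I \<subseteq> T"
    using M sub by auto
qed

section \<open>Squarefree monomials as finite sets\<close>

text \<open>The product of the variables indexed by \<open>X\<close>. For infinite \<open>X\<close>
  the sum defaults to 0, the monomial 1, hence the finiteness hypotheses below.\<close>

definition sqmon :: "nat set \<Rightarrow> monom" where
  "sqmon X = (\<Sum>i\<in>X. Poly_Mapping.single i 1)"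

lemma lookup_sqmon: "finite X \<Longrightarrow> Poly_Mapping.lookup (sqmon X) i = of_bool (i \<in> X)"
  by (simp add: sqmon_def lookup_sum lookup_single when_def)

lemma keys_sqmon: "finite X \<Longrightarrow> Poly_Mapping.keys (sqmon X) = X"
  by (auto simp: in_keys_iff lookup_sqmon)

lemma sqfree_sqmon: "finite X \<Longrightarrow> sqfree (sqmon X)"
  by (simp add: sqfree_def lookup_sqmon)

lemma sqfree_lookup: "sqfree u \<Longrightarrow> Poly_Mapping.lookup u i = of_bool (i \<in> Poly_Mapping.keys u)"
  by (cases "i \<in> Poly_Mapping.keys u")
    (auto simp: sqfree_def in_keys_iff intro!: le_antisym dest: spec[of _ i])

lemma sqmon_keys: "sqfree u \<Longrightarrow> sqmon (Poly_Mapping.keys u) = u"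
  by (rule poly_mapping_eqI) (simp add: lookup_sqmon sqfree_lookup)

lemma sqfree_eqI: "sqfree u \<Longrightarrow> sqfree v \<Longrightarrow> Poly_Mapping.keys u = Poly_Mapping.keys v \<Longrightarrow> u = v"
  by (metis sqmon_keys)

lemma mdeg_sqfree: "sqfree u \<Longrightarrow> mdeg u = card (Poly_Mapping.keys u)"
  by (simp add: mdeg_def sqfree_lookup)

lemma mdeg_sqmon: "finite X \<Longrightarrow> mdeg (sqmon X) = card X"
  by (simp add: mdeg_sqfree sqfree_sqmon keys_sqmon)

lemma sqmon_in_monoms_iff: "finite X \<Longrightarrow> sqmon X \<in> monoms n \<longleftrightarrow> X \<subseteq> {1..n}"
  by (simp add: monoms_def keys_sqmon)

lemma mon_dvd_keys: "mon_dvd s u \<Longrightarrow> Poly_Mapping.keys s \<subseteq> Poly_Mapping.keys u"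
  by (auto simp: mon_dvd_def keys_add_monom)

lemma sqfree_mon_dvd:
  assumes "sqfree s" "sqfree u" "Poly_Mapping.keys s \<subseteq> Poly_Mapping.keys u"
  shows "mon_dvd s u"
  unfolding mon_dvd_def
proof
  let ?X = "Poly_Mapping.keys u - Poly_Mapping.keys s"
  show "u = s + sqmon ?X"
    using assms by (intro poly_mapping_eqI) (auto simp: lookup_add lookup_sqmon sqfree_lookup)
qed

lemma finite_sqfree_monoms: "finite {u \<in> monoms n. sqfree u}"
proof (rule finite_subset)
  show "{u \<in> monoms n. sqfree u} \<subseteq> sqmon ` Pow {1..n}"
  proof
    fix u assume "u \<in> {u \<in> monoms n. sqfree u}"
    then have "u = sqmon (Poly_Mapping.keys u)" "Poly_Mapping.keys u \<in> Pow {1..n}"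
      by (simp_all add: monoms_def sqmon_keys)
    then show "u \<in> sqmon ` Pow {1..n}"
      by (rule image_eqI)
  qed
qed simp

section \<open>The squarefree lexicographic order\<close>

text \<open>Replaces index lists by index sets: the entry of \<open>u\<close> at the first position
  of disagreement is the least element of the symmetric difference.\<close>

lemma slex_gt_imp_keys:
  assumes "slex_gt u v"
  shows "\<exists>i\<in>Poly_Mapping.keys u - Poly_Mapping.keys v.
    \<forall>k<i. k \<in> Poly_Mapping.keys u \<longleftrightarrow> k \<in> Poly_Mapping.keys v"
proof -
  obtain s where s: "s < mdeg u" "\<And>t. t < s \<Longrightarrow> indices u ! t = indices v ! t"
      "indices u ! s < indices v ! s" and sq: "sqfree u" "sqfree v" "mdeg u = mdeg v"
    using assms unfolding slex_gt_def by blast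
  have len: "length (indices u) = mdeg u" "length (indices v) = mdeg u"
    using sq by (simp_all add: indices_def mdeg_sqfree[symmetric])
  have strict: "sorted_wrt (<) (indices w)" and set: "set (indices w) = Poly_Mapping.keys w" for w
    by (simp_all add: indices_def)
  \<comment> \<open>In a strictly increasing list, an element below the entry at \<open>s\<close>
    occurs before position \<open>s\<close>.\<close>
  have earlier: "\<exists>t<s. indices w ! t = k"
    if k: "k \<in> Poly_Mapping.keys w" "k < indices w ! s" and w: "length (indices w) = mdeg u" for k w
  proof -
    obtain t where t: "t < mdeg u" "indices w ! t = k"
      using k(1) w by (metis set in_set_conv_nth)
    have "t < s"
      using t k(2) w strict[of w] s(1)
      by (metis leD linorder_neqE_nat nat_less_le sorted_wrt_iff_nth_less)
    then show ?thesis
      using t by blast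
  qed
  define i where "i = indices u ! s"
  have mem: "indices w ! t \<in> Poly_Mapping.keys w" if "t < mdeg u" "length (indices w) = mdeg u" for t w
    using that by (metis set nth_mem)
  have lt: "indices u ! t < i" if "t < s" for t
    using that s(1) len strict[of u] by (simp add: i_def sorted_wrt_iff_nth_less)
  have "i \<in> Poly_Mapping.keys u"
    using mem s len by (simp add: i_def)
  \<comment> \<open>Otherwise \<open>i\<close>, being below \<open>indices v ! s\<close>, would be
    one of the first \<open>s\<close> entries of \<open>v\<close>; these agree with those of
    \<open>u\<close>, which are all below \<open>i\<close>.\<close>
  moreover have "i \<notin> Poly_Mapping.keys v"
    using earlier[of i v] lt s(2,3) len unfolding i_def by (metis less_irrefl)
  moreover have "k \<in> Poly_Mapping.keys u \<longleftrightarrow> k \<in> Poly_Mapping.keys v" if ki: "k < i" for k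
  proof
    assume "k \<in> Poly_Mapping.keys u"
    then obtain t where "t < s" "indices u ! t = k"
      using earlier[of k u] ki len by (auto simp: i_def)
    then show "k \<in> Poly_Mapping.keys v"
      using mem[of t v] s len by auto
  next
    assume "k \<in> Poly_Mapping.keys v"
    then obtain t where "t < s" "indices v ! t = k"
      using earlier[of k v] ki len s(3) by (auto simp: i_def)
    then show "k \<in> Poly_Mapping.keys u"
      using mem[of t u] s len by auto
  qed
  ultimately show ?thesis
    by blast
qed

lemma slex_gt_iff_keys:
  "slex_gt u v \<longleftrightarrow> sqfree u \<and> sqfree v \<and> mdeg u = mdeg v \<and>
     (\<exists>i\<in>Poly_Mapping.keys u - Poly_Mapping.keys v.
        \<forall>k<i. k \<in> Poly_Mapping.keys u \<longleftrightarrow> k \<in> Poly_Mapping.keys v)"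
proof
  assume "slex_gt u v"
  then show "sqfree u \<and> sqfree v \<and> mdeg u = mdeg v \<and>
     (\<exists>i\<in>Poly_Mapping.keys u - Poly_Mapping.keys v.
        \<forall>k<i. k \<in> Poly_Mapping.keys u \<longleftrightarrow> k \<in> Poly_Mapping.keys v)"
    using slex_gt_imp_keys by (auto simp: slex_gt_def)
next
  assume *: "sqfree u \<and> sqfree v \<and> mdeg u = mdeg v \<and>
     (\<exists>i\<in>Poly_Mapping.keys u - Poly_Mapping.keys v.
        \<forall>k<i. k \<in> Poly_Mapping.keys u \<longleftrightarrow> k \<in> Poly_Mapping.keys v)"
  then obtain i where i: "i \<in> Poly_Mapping.keys u" "i \<notin> Poly_Mapping.keys v"
    "\<And>k. k < i \<Longrightarrow> k \<in> Poly_Mapping.keys u \<longleftrightarrow> k \<in> Poly_Mapping.keys v"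
    by blast
  have len: "length (indices u) = mdeg u" "length (indices v) = mdeg u"
    using * by (simp_all add: indices_def mdeg_sqfree[symmetric])
  have "indices u \<noteq> indices v"
    using i(1,2) by (metis indices_def finite_keys set_sorted_list_of_set)
  then have "\<exists>s. s < mdeg u \<and> indices u ! s \<noteq> indices v ! s"
    using len by (auto simp: list_eq_iff_nth_eq)
  then obtain s where s: "s < mdeg u" "indices u ! s \<noteq> indices v ! s"
    and first: "\<forall>t<s. indices u ! t = indices v ! t"
    using exists_least_iff[of "\<lambda>s. s < mdeg u \<and> indices u ! s \<noteq> indices v ! s"]
    by (meson less_trans)
  \<comment> \<open>The symmetric difference of the index sets has only one least element, and it
    lies in \<open>u\<close>. Excluding this order settles the comparison at \<open>s\<close> by
    linearity.\<close>
  have "\<not> slex_gt v u"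
    using slex_gt_imp_keys[of v u] i by (metis Diff_iff linorder_neqE_nat)
  then have "indices u ! s < indices v ! s"
    using * s first unfolding slex_gt_def by (metis linorder_neqE_nat)
  then show "slex_gt u v"
    using * s first unfolding slex_gt_def by blast
qed

text \<open>The least index \<open>i\<close> in which the two differ lies in \<open>v\<close> only,
  so it cannot be among \<open>1, ..., d - 1\<close>, and below \<open>i\<close> both agree. For the
  second claim take \<open>i\<close> if \<open>i \<le> j\<close>, and otherwise \<open>j\<close>
  itself.\<close>

lemma slex_gt_initial:
  assumes "slex_gt v u" "v \<in> monoms n" "{1..<d} \<subseteq> Poly_Mapping.keys u"
    and "j \<in> Poly_Mapping.keys u" "d \<le> j"
  shows "{1..<d} \<subseteq> Poly_Mapping.keys v" "\<exists>i\<in>Poly_Mapping.keys v. d \<le> i \<and> i \<le> j"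
proof -
  obtain i where i: "i \<in> Poly_Mapping.keys v" "i \<notin> Poly_Mapping.keys u"
    and below: "\<And>k. k < i \<Longrightarrow> k \<in> Poly_Mapping.keys v \<longleftrightarrow> k \<in> Poly_Mapping.keys u"
    using assms(1) unfolding slex_gt_iff_keys by blast
  have "1 \<le> i"
    using i(1) assms(2) by (auto simp: monoms_def)
  then have "d \<le> i"
    using i(2) assms(3) by (meson atLeastLessThan_iff not_le subsetD)
  then show "{1..<d} \<subseteq> Poly_Mapping.keys v"
    using below assms(3) by auto
  show "\<exists>i\<in>Poly_Mapping.keys v. d \<le> i \<and> i \<le> j"
    using \<open>d \<le> i\<close> i(1) below[of j] assms(4,5) by (cases "j < i") auto
qed

text \<open>The monomial \<open>X_1 ... X_(d-1) X_j\<close>. For \<open>j = d, ..., n\<close> these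
  are the largest squarefree monomials of degree \<open>d\<close> in \<open>n\<close> variables, in
  decreasing order.\<close>

definition lexmon :: "nat \<Rightarrow> nat \<Rightarrow> monom" where
  "lexmon d j = sqmon (insert j {1..<d})"

lemma keys_lexmon: "Poly_Mapping.keys (lexmon d j) = insert j {1..<d}"
  by (simp add: lexmon_def keys_sqmon)

lemma sqfree_lexmon: "sqfree (lexmon d j)"
  by (simp add: lexmon_def sqfree_sqmon)

lemma mdeg_lexmon: "1 \<le> d \<Longrightarrow> d \<le> j \<Longrightarrow> mdeg (lexmon d j) = d"
  by (simp add: lexmon_def mdeg_sqmon)

lemma lexmon_in_monoms: "1 \<le> d \<Longrightarrow> d \<le> j \<Longrightarrow> j \<le> n \<Longrightarrow> lexmon d j \<in> monoms n"
  by (auto simp: lexmon_def sqmon_in_monoms_iff)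

lemma card_lexmon: "card (lexmon d ` {d..n}) = Suc n - d"
proof -
  have "inj_on (lexmon d) {d..n}"
  proof (rule inj_onI)
    fix i j assume "i \<in> {d..n}" "j \<in> {d..n}" "lexmon d i = lexmon d j"
    then show "i = j"
      using keys_lexmon[of d i] keys_lexmon[of d j] by auto
  qed
  then show ?thesis
    by (simp add: card_image)
qed

lemma sqfree_initial_eq_lexmon:
  assumes "u \<in> monoms n" "sqfree u" "mdeg u = d" "1 \<le> d" "{1..<d} \<subseteq> Poly_Mapping.keys u"
  shows "u \<in> lexmon d ` {d..n}"
proof -
  \<comment> \<open>Of \<open>d\<close> indices, the \<open>d - 1\<close> initial ones are removed;
    \<open>1 \<le> d\<close> keeps the truncated subtraction exact.\<close>
  have "card (Poly_Mapping.keys u - {1..<d}) = 1"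
    using assms by (simp add: card_Diff_subset mdeg_sqfree)
  then obtain j where j: "Poly_Mapping.keys u - {1..<d} = {j}"
    by (auto simp: card_1_singleton_iff)
  then have "Poly_Mapping.keys u = insert j {1..<d}"
    using assms(5) by blast
  then have "u = lexmon d j"
    by (intro sqfree_eqI) (simp_all add: assms sqfree_lexmon keys_lexmon)
  moreover have "j \<in> {d..n}"
  proof -
    have "j \<in> {1..n}" "j \<notin> {1..<d}"
      using j assms(1) by (auto simp: monoms_def)
    then show ?thesis by auto
  qed
  ultimately show ?thesis
    by blast
qed

text \<open>The order is decided at the least index below \<open>d\<close> missing from
  \<open>u\<close>, whatever \<open>j\<close> is. In particular \<open>j\<close> may exceed
  \<open>n\<close>, which admits a new variable.\<close>

lemma lexmon_slex_gt:
  assumes "u \<in> monoms n" "sqfree u" "mdeg u = d" "1 \<le> d" "d \<le> j"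
    and "\<not> {1..<d} \<subseteq> Poly_Mapping.keys u"
  shows "slex_gt (lexmon d j) u"
proof -
  define P where "P i \<longleftrightarrow> i \<in> {1..<d} \<and> i \<notin> Poly_Mapping.keys u" for i
  have "\<exists>i. P i"
    using assms(6) by (auto simp: P_def)
  then obtain i where i: "P i" "\<And>k. k < i \<Longrightarrow> \<not> P k"
    using exists_least_iff[of P] by blast
  have "k \<in> Poly_Mapping.keys (lexmon d j) \<longleftrightarrow> k \<in> Poly_Mapping.keys u" if "k < i" for k
    using that i(1) i(2)[OF that] assms(1,5) by (cases "k = 0") (auto simp: P_def keys_lexmon monoms_def)
  moreover have "i \<in> Poly_Mapping.keys (lexmon d j) - Poly_Mapping.keys u"
    using i(1) by (simp add: P_def keys_lexmon)
  ultimately show ?thesis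
    using assms(2-5) sqfree_lexmon mdeg_lexmon unfolding slex_gt_iff_keys by metis
qed

lemma lexmon_slex_gt_lexmon:
  assumes "1 \<le> d" "d \<le> i" "i < j"
  shows "slex_gt (lexmon d i) (lexmon d j)"
  unfolding slex_gt_iff_keys using assms
  by (auto simp: keys_lexmon sqfree_lexmon mdeg_lexmon intro!: bexI[of _ i])

section \<open>Squarefree lexsegment ideals generated in one degree\<close>

locale lexsegment_gens =
  fixes n d :: nat and I :: "'k::field poly set"
  assumes lexsegment: "sqfree_lexsegment n I" and degree: "generated_in_degree n I d"
begin

lemma monomial: "monomial_ideal n I"
  using degree by (simp add: generated_in_degree_def)

lemma d_pos: "1 \<le> d"
  using degree by (simp add: generated_in_degree_def)

lemma gens_monoms: "G n I \<subseteq> monoms n"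
  using min_gens_G(1)[OF monomial] by (simp add: min_gens_def)

lemma Idl_gens: "I = Idl\<^bsub>poly_ring n\<^esub> (mon ` G n I)"
  using min_gens_G(1)[OF monomial] unfolding min_gens_def by blast

text \<open>The lexsegment property only provides some squarefree generating set; the minimal one is
  contained in it.\<close>

lemma gens_sqfree: "u \<in> G n I \<Longrightarrow> sqfree u"
  using lexsegment min_gens_G(2)[OF monomial] unfolding sqfree_lexsegment_def by blast

lemma gens_mdeg: "u \<in> G n I \<Longrightarrow> mdeg u = d"
  using degree by (simp add: generated_in_degree_def)

lemma finite_gens: "finite (G n I)"
  using finite_subset[OF _ finite_sqfree_monoms[of n]] gens_monoms gens_sqfree by blast

lemma d_le_n: "d \<le> n"
proof -
  obtain u where u: "u \<in> G n I"
    using degree by (auto simp: generated_in_degree_def)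
  then have "d = card (Poly_Mapping.keys u)"
    using gens_mdeg gens_sqfree mdeg_sqfree by metis
  also have "\<dots> \<le> card {1..n}"
    using u gens_monoms by (intro card_mono) (auto simp: monoms_def)
  finally show ?thesis
    by simp
qed

lemma gens_monoms_extension: "G n I \<subseteq> monoms (n + m)"
  using gens_monoms monoms_mono[of n "n + m"] by auto

lemma Idl_extension_gens:
  "Idl\<^bsub>poly_ring (n + m)\<^esub> I = Idl\<^bsub>poly_ring (n + m)\<^esub> (mon ` G n I)"
  using Idl_extension[OF gens_monoms, of "n + m", where 'k = 'k] Idl_gens by simp

lemma mon_in_extension_iff:
  "mon u \<in> Idl\<^bsub>poly_ring (n + m)\<^esub> I \<longleftrightarrow> u \<in> monoms (n + m) \<and> (\<exists>s\<in>G n I. mon_dvd s u)"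
  unfolding Idl_extension_gens by (rule mon_in_Idl_iff[OF gens_monoms_extension])

text \<open>A generator dividing a monomial of its own degree equals it, so adjoining variables adds
  no monomials to the ideal in degree \<open>d\<close>.\<close>

lemma mon_in_extension_degree_iff:
  assumes "mdeg u = d"
  shows "mon u \<in> Idl\<^bsub>poly_ring (n + m)\<^esub> I \<longleftrightarrow> u \<in> G n I"
  using assms gens_mdeg mon_dvd_mdeg_eq mon_dvd_refl gens_monoms_extension
  unfolding mon_in_extension_iff by (metis subsetD)

lemma gens_mon_in: "u \<in> G n I \<Longrightarrow> mon u \<in> I"
  using mon_in_Idl_iff[OF gens_monoms, where 'k = 'k] gens_monoms mon_dvd_refl Idl_gens by blast

lemma gens_upward:
  assumes u: "u \<in> G n I" and "slex_gt v u" "v \<in> monoms n"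
  shows "v \<in> G n I"
proof -
  have v: "sqfree v" "mdeg v = d"
    using assms gens_mdeg by (auto simp: slex_gt_def)
  have "mon v \<in> I"
    using lexsegment assms gens_monoms gens_mon_in[OF u] gens_sqfree gens_mdeg v
    unfolding sqfree_lexsegment_def by (metis subsetD)
  then obtain s where "s \<in> G n I" "mon_dvd s v"
    using Idl_gens mon_in_Idl_iff[OF gens_monoms, where 'k = 'k] by blast
  then show ?thesis
    using v gens_mdeg mon_dvd_mdeg_eq by metis
qed

section \<open>Equivalence of divisibility, the bound and universality\<close>

definition all_initial :: bool where
  "all_initial \<longleftrightarrow> (\<forall>u\<in>G n I. {1..<d} \<subseteq> Poly_Mapping.keys u)"

lemma all_initial_gens: "all_initial \<Longrightarrow> G n I \<subseteq> lexmon d ` {d..n}"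
  using gens_monoms gens_sqfree gens_mdeg d_pos unfolding all_initial_def
  by (intro subsetI sqfree_initial_eq_lexmon) blast+

lemma all_initial_iff_card: "all_initial \<longleftrightarrow> card (G n I) \<le> Suc n - d"
proof
  assume all_initial
  then show "card (G n I) \<le> Suc n - d"
    using card_mono[OF _ all_initial_gens] card_lexmon by simp
next
  assume card: "card (G n I) \<le> Suc n - d"
  show all_initial
  proof (rule ccontr)
    assume "\<not> all_initial"
    then obtain w where w: "w \<in> G n I" "\<not> {1..<d} \<subseteq> Poly_Mapping.keys w"
      by (auto simp: all_initial_def)
    have "lexmon d j \<in> G n I" if "d \<le> j" "j \<le> n" for j
      using that w d_pos gens_monoms gens_sqfree gens_mdeg
      by (intro gens_upward[OF w(1)] lexmon_slex_gt[where n = n] lexmon_in_monoms) auto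
    \<comment> \<open>All \<open>Suc n - d\<close> monomials \<open>lexmon d j\<close> exceed
      \<open>w\<close> and are therefore generators; \<open>w\<close> itself is one too
      many.\<close>
    then have "insert w (lexmon d ` {d..n}) \<subseteq> G n I"
      using w(1) by auto
    then have "card (insert w (lexmon d ` {d..n})) \<le> card (G n I)"
      using finite_gens by (intro card_mono)
    moreover have "w \<notin> lexmon d ` {d..n}"
      using w(2) keys_lexmon by auto
    ultimately show False
      using card by (simp add: card_lexmon)
  qed
qed

lemma all_initial_if_USLI:
  assumes "USLI n I"
  shows all_initial
proof (rule ccontr)
  assume "\<not> all_initial"
  then obtain w where w: "w \<in> G n I" "\<not> {1..<d} \<subseteq> Poly_Mapping.keys w"
    by (auto simp: all_initial_def)
  have "slex_gt (lexmon d (n + 1)) w"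
    using w gens_monoms gens_sqfree gens_mdeg d_pos d_le_n
    by (intro lexmon_slex_gt[where n = n]) auto
  moreover have "lexmon d (n + 1) \<in> monoms (n + 1)" "mdeg (lexmon d (n + 1)) = d"
    using d_pos d_le_n by (auto intro!: lexmon_in_monoms mdeg_lexmon)
  moreover have "w \<in> monoms (n + 1)"
    using w gens_monoms_extension by blast
  moreover have "sqfree_lexsegment (n + 1) (Idl\<^bsub>poly_ring (n + 1)\<^esub> I)"
    using assms unfolding USLI_def by blast
  \<comment> \<open>The lexsegment property for \<open>m = 1\<close> puts this monomial into the
    extended ideal, and its degree \<open>d\<close> makes it a generator, although it involves the
    variable \<open>n + 1\<close>.\<close>
  ultimately have "lexmon d (n + 1) \<in> G n I"
    unfolding sqfree_lexsegment_def
    using gens_mdeg[OF w(1)] gens_sqfree[OF w(1)] sqfree_lexmon w(1) mon_in_extension_degree_iff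
    by metis
  then show False
    using gens_monoms by (auto simp: monoms_def keys_lexmon dest!: subsetD)
qed

text \<open>Let \<open>lexmon d j\<close> be a generator dividing \<open>u\<close>. A larger
  \<open>v\<close> of the same degree, which may exceed \<open>d\<close>, is divisible by some
  \<open>lexmon d i\<close> with \<open>d \<le> i \<le> j\<close>, and this is again a
  generator.\<close>

lemma USLI_if_all_initial:
  assumes init: all_initial
  shows "USLI n I"
proof -
  have "sqfree_lexsegment (n + m) (Idl\<^bsub>poly_ring (n + m)\<^esub> I)" for m
    unfolding sqfree_lexsegment_def
  proof (intro conjI ballI impI)
    let ?R = "poly_ring (n + m) :: 'k poly ring" and ?J = "Idl\<^bsub>poly_ring (n + m)\<^esub> I"
    \<comment> \<open>Properness: \<open>mon 0\<close> is the constant 1, and the generators have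
      degree \<open>d \<ge> 1\<close>.\<close>
    have "(mon 0 :: 'k poly) \<notin> ?J"
    proof
      assume "(mon 0 :: 'k poly) \<in> ?J"
      then obtain s where "s \<in> G n I" "mon_dvd s 0"
        by (auto simp: mon_in_extension_iff)
      then show False
        using gens_mdeg mon_dvd_mdeg_le d_pos mdeg_eq_0_iff by (metis le_zero_eq not_one_le_zero)
    qed
    moreover have "(mon 0 :: 'k poly) \<in> carrier ?R"
      by (simp add: poly_ring_def mon_def monoms_def)
    moreover have "?J \<subseteq> carrier ?R"
      unfolding Idl_extension_gens Idl_mon_eq[OF gens_monoms_extension]
      by (auto simp: mon_multiples_def poly_ring_def)
    ultimately show "?J \<subset> carrier ?R"
      by blast
    show "\<exists>S\<subseteq>monoms (n + m). (\<forall>u\<in>S. sqfree u) \<and> ?J = Idl\<^bsub>?R\<^esub> (mon ` S)"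
      using gens_monoms_extension gens_sqfree Idl_extension_gens by (intro exI[of _ "G n I"]) auto
    fix u v assume v: "v \<in> monoms (n + m)"
      and "sqfree u \<and> mon u \<in> ?J \<and> sqfree v \<and> mdeg u = mdeg v \<and> slex_gt v u"
    then have gt: "slex_gt v u" and sq: "sqfree v" and u: "mon u \<in> ?J"
      by auto
    obtain s where s: "s \<in> G n I" "mon_dvd s u"
      using u by (auto simp: mon_in_extension_iff)
    obtain j where j: "s = lexmon d j" "d \<le> j" "j \<le> n"
      using s(1) all_initial_gens[OF init] by auto
    have u_keys: "{1..<d} \<subseteq> Poly_Mapping.keys u" "j \<in> Poly_Mapping.keys u"
      using mon_dvd_keys[OF s(2)] by (simp_all add: j keys_lexmon)
    obtain i where i: "i \<in> Poly_Mapping.keys v" "d \<le> i" "i \<le> j" "{1..<d} \<subseteq> Poly_Mapping.keys v"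
      using slex_gt_initial[OF gt v u_keys j(2)] by blast
    \<comment> \<open>Since \<open>i \<le> j \<le> n\<close>, no new variable occurs, and the
      lexsegment property of \<open>I\<close> in the original ring suffices.\<close>
    have "lexmon d i \<in> G n I"
    proof (cases "i = j")
      case False
      then have "i < j"
        using i(3) by simp
      show ?thesis
      proof (rule gens_upward[OF s(1)])
        show "slex_gt (lexmon d i) s"
          unfolding j(1) by (rule lexmon_slex_gt_lexmon[OF d_pos i(2) \<open>i < j\<close>])
        show "lexmon d i \<in> monoms n"
          using i(3) j(3) by (intro lexmon_in_monoms[OF d_pos i(2)]) simp
      qed
    qed (use s(1) j(1) in simp)
    moreover have "mon_dvd (lexmon d i) v"
      using i(1,4) sq by (intro sqfree_mon_dvd sqfree_lexmon) (simp_all add: keys_lexmon)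
    ultimately show "mon v \<in> ?J"
      using v mon_in_extension_iff by blast
  qed
  then show ?thesis
    using lexsegment by (simp add: USLI_def)
qed

end

theorem proposition2p3:
  fixes n d :: nat and I :: "'k::field poly set"
  assumes "sqfree_lexsegment n I" and "generated_in_degree n I d"
  shows "USLI n I \<longleftrightarrow> int (card (G n I)) \<le> int n - int d + 1"
proof -
  interpret lexsegment_gens n d I
    using assms by unfold_locales
  have "USLI n I \<longleftrightarrow> card (G n I) \<le> Suc n - d"
    using all_initial_if_USLI USLI_if_all_initial all_initial_iff_card by blast
  \<comment> \<open>\<open>d \<le> n\<close> makes the natural number \<open>Suc n - d\<close> agree
    with the integer bound.\<close>
  then show ?thesis
    using d_le_n by linarith
qed

end
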